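(* Let $C$ be a $2$-torsion free commutative ring with unity, let $n\geq 2$, and let $\mathcal{T}_n(C)$ be the $C$-algebra of $n\times n$ upper triangular matrices over $C$. Let $f,g,h:\mathcal{T}_n(C)\rightarrow \mathcal{T}_n(C)$ be $C$-linear maps. Then $f$ is a Jordan left $\{g,h\}$-derivation if and only if there exist $\frac{n(n+3)}{2}$ elements of $C$, namely $g_{kj}^{(kk)}\in C$ for $1\leq k\leq j\leq n$ and $h_{1j}^{(11)}\in C$ for $1\leq j\leq n$, such that for every $A=\sum_{1\leq i\leq j\leq n}a_{ij}e_{ij}\in\mathcal{T}_n(C)$ (with $a_{ij}\in C$), $$g(A)=\sum_{1 \leq i \leq j \leq n}\Big(\sum_{k=i}^{j}a_{ik}g_{kj}^{(kk)}\Big)e_{ij},$$ $$h(A)=a_{11}h_{11}^{(11)}e_{11}+\sum_{j=2}^{n}\Big(a_{11}h_{1j}^{(11)}+\sum_{k=2}^{j}a_{1k}g_{kj}^{(kk)}\Big)e_{1j}+\sum_{1 < i \leq j \leq n}\Big(\sum_{k=i}^{j}a_{ik}g_{kj}^{(kk)}\Big)e_{ij},$$ $$f(A)=g(A)+h(A).$$ Moreover, if $f$ is a Jordan left $\{g,h\}$-derivation of $\mathcal{T}_n(C)$, then $f$, $g$ and $h$ are right centralizers.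
   Context: A ring $R$ is $2$-torsion free if $2a=0$ with $a\in R$ implies $a=0$. For an algebra $A$ over $C$ and $C$-linear maps $f,g,h:A\to A$, $f$ is a Jordan left $\{g,h\}$-derivation if $f(ab+ba)=2\big(a\,g(b)+b\,h(a)\big)$ for all $a,b\in A$. A linear map $\varphi:A\to A$ is a right centralizer if $\varphi(ab)=a\varphi(b)$ for all $a,b\in A$. $e_{ij}$ denotes the matrix whose $(i,j)$ entry is $1$ and whose other entries are $0$. The superscripts in $g_{kj}^{(kk)}$ and $h_{1j}^{(11)}$ are just part of the names of the elements. *)

theory Defs
  imports "Jordan_Normal_Form.Matrix"
begin

text \<open>
  The coefficient ring has sort \<open>{comm_ring, semiring_numeral}\<close>: a commutative ring with unity in
  which \<open>0 = 1\<close> is not excluded (as it would be by \<open>comm_ring_1\<close>, a subclass of both). The class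
  \<open>semiring_numeral\<close> contributes the unit, hence the numeral \<open>2 = 1 + 1\<close>, and no further axioms.
\<close>

definition two_torsion_free :: "'a :: {comm_ring, semiring_numeral} itself \<Rightarrow> bool" where
  "two_torsion_free _ \<longleftrightarrow> (\<forall>c :: 'a. 2 * c = 0 \<longrightarrow> c = 0)"

definition upper_triangular_mats :: "nat \<Rightarrow> 'a :: zero mat set" where
  "upper_triangular_mats n = {A \<in> carrier_mat n n. upper_triangular A}"

text \<open>Below, \<open>S\<close> is the carrier of an algebra of matrices; maps are total functions on
  the matrix type, of which only the values on \<open>S\<close> are relevant.\<close>

definition linear_map_on :: "'a :: semiring_0 mat set \<Rightarrow> ('a mat \<Rightarrow> 'a mat) \<Rightarrow> bool" where
  "linear_map_on S f \<longleftrightarrow>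
     (\<forall>A\<in>S. f A \<in> S) \<and>
     (\<forall>A\<in>S. \<forall>B\<in>S. f (A + B) = f A + f B) \<and>
     (\<forall>c. \<forall>A\<in>S. f (c \<cdot>\<^sub>m A) = c \<cdot>\<^sub>m f A)"

definition jordan_left_derivation_on ::
  "'a :: {comm_ring, semiring_numeral} mat set \<Rightarrow>
     ('a mat \<Rightarrow> 'a mat) \<Rightarrow> ('a mat \<Rightarrow> 'a mat) \<Rightarrow> ('a mat \<Rightarrow> 'a mat) \<Rightarrow> bool" where
  "jordan_left_derivation_on S g h f \<longleftrightarrow>
     (\<forall>A\<in>S. \<forall>B\<in>S. f (A * B + B * A) = 2 \<cdot>\<^sub>m (A * g B + B * h A))"

definition right_centralizer_on :: "'a :: semiring_0 mat set \<Rightarrow> ('a mat \<Rightarrow> 'a mat) \<Rightarrow> bool" where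
  "right_centralizer_on S \<phi> \<longleftrightarrow>
     linear_map_on S \<phi> \<and> (\<forall>A\<in>S. \<forall>B\<in>S. \<phi> (A * B) = A * \<phi> B)"

text \<open>The matrix unit \<open>e\<^sub>i\<^sub>j\<close> with \<open>i, j\<close> counted from 1, whereas \<open>$$\<close> counts from 0.\<close>

definition mat_unit :: "nat \<Rightarrow> nat \<Rightarrow> nat \<Rightarrow> 'a :: {zero, one} mat" where
  "mat_unit n i j = mat n n (\<lambda>(r, s). if Suc r = i \<and> Suc s = j then 1 else 0)"

text \<open>Finite sum of \<open>n \<times> n\<close> matrices. \<open>sum\<close> does not apply because the type \<open>mat\<close>, containing
  matrices of all dimensions, has no zero; the library's \<open>module_mat\<close> requires \<open>0 \<noteq> 1\<close>.\<close>

definition mat_sum :: "nat \<Rightarrow> 'i set \<Rightarrow> ('i \<Rightarrow> 'a :: comm_monoid_add mat) \<Rightarrow> 'a mat" where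
  "mat_sum n I F = mat n n (\<lambda>rs. \<Sum>x\<in>I. F x $$ rs)"

lemma mat_sum_empty: "mat_sum n {} F = 0\<^sub>m n n"
  by (auto simp: mat_sum_def)

lemma mat_sum_insert:
  assumes "finite I" "x \<notin> I" "F x \<in> carrier_mat n n"
  shows "mat_sum n (insert x I) F = F x + mat_sum n I F"
  using assms by (intro eq_matI) (auto simp: mat_sum_def)

text \<open>Every upper triangular matrix is of the form \<open>\<Sum>\<^bsub>1 \<le> i \<le> j \<le> n\<^esub> a\<^sub>i\<^sub>j e\<^sub>i\<^sub>j\<close>.\<close>

lemma upper_triangular_mats_expansion:
  fixes A :: "'a :: {comm_ring, semiring_numeral} mat"
  assumes "A \<in> upper_triangular_mats n"
  shows "A = mat_sum n {(i, j). 1 \<le> i \<and> i \<le> j \<and> j \<le> n}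
               (\<lambda>(i, j). (A $$ (i - 1, j - 1)) \<cdot>\<^sub>m mat_unit n i j)"
proof (rule eq_matI)
  let ?I = "{(i, j). 1 \<le> i \<and> i \<le> j \<and> j \<le> n}"
  let ?S = "mat_sum n ?I (\<lambda>(i, j). (A $$ (i - 1, j - 1)) \<cdot>\<^sub>m mat_unit n i j)"
  have A: "A \<in> carrier_mat n n" and ut: "upper_triangular A"
    using assms by (auto simp: upper_triangular_mats_def)
  show "dim_row A = dim_row ?S" "dim_col A = dim_col ?S"
    using A by (auto simp: mat_sum_def)
  fix r s assume "r < dim_row ?S" "s < dim_col ?S"
  then have rs: "r < n" "s < n" by (auto simp: mat_sum_def)
  have fin: "finite ?I" by (rule finite_subset[of _ "{..n} \<times> {..n}"]) auto
  have "?S $$ (r, s) = (\<Sum>x\<in>?I. if x = (Suc r, Suc s) then A $$ (r, s) else 0)"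
    unfolding mat_sum_def using rs
    by (auto intro!: sum.cong simp: mat_unit_def)
  also have "\<dots> = A $$ (r, s)"
    using fin rs A ut by (auto simp: upper_triangularD)
  finally show "A $$ (r, s) = ?S $$ (r, s)" by simp
qed

end

theory Submission
  imports Defs
begin

text \<open>
  Taking one argument of the Jordan identity to be \<open>1\<close> gives
  \<open>f A = A g(1) + h A = g A + A h(1)\<close>.
  For an idempotent \<open>e\<close> the Jordan identity then forces \<open>f e = e (g(1) + h(1))\<close>, and the algebra of
  upper triangular matrices is spanned by the idempotents \<open>e\<^sub>i\<^sub>i\<close> and \<open>e\<^sub>i\<^sub>i + e\<^sub>i\<^sub>j\<close>; hence \<open>f\<close>, \<open>g\<close>, \<open>h\<close> are
  right multiplications by \<open>g(1) + h(1)\<close>, \<open>g(1)\<close>, \<open>h(1)\<close>. What remains of the Jordan identity is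
  \<open>(AB - BA)(g(1) - h(1)) = 0\<close>. Commutators are strictly upper triangular and include every \<open>e\<^sub>1\<^sub>j\<close>
  with \<open>j \<ge> 2\<close>, so this says that \<open>g(1)\<close> and \<open>h(1)\<close> agree outside the first row.
\<close>

section \<open>Products, sums and closure properties of upper triangular matrices\<close>

abbreviation (input) upper_indices :: "nat \<Rightarrow> (nat \<times> nat) set" where
  "upper_indices n \<equiv> {(i, j). 1 \<le> i \<and> i \<le> j \<and> j \<le> n}"

lemma finite_upper_indices: "finite (upper_indices n)"
  by (rule finite_subset[of _ "{..n} \<times> {..n}"]) auto

lemma upper_triangular_matsI:
  assumes "A \<in> carrier_mat n n" "\<And>i j. j < i \<Longrightarrow> i < n \<Longrightarrow> A $$ (i, j) = 0"
  shows "A \<in> upper_triangular_mats n"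
  using assms by (auto simp: upper_triangular_mats_def)

lemma upper_triangular_matsD:
  assumes "A \<in> upper_triangular_mats n"
  shows "A \<in> carrier_mat n n" "j < i \<Longrightarrow> i < n \<Longrightarrow> A $$ (i, j) = 0"
    "dim_row A = n" "dim_col A = n"
  using assms by (auto simp: upper_triangular_mats_def)

lemma index_mult_square_mat:
  fixes A B :: "'a :: semiring_0 mat"
  assumes "A \<in> carrier_mat n n" "B \<in> carrier_mat n n" "i < n" "j < n"
  shows "(A * B) $$ (i, j) = (\<Sum>k<n. A $$ (i, k) * B $$ (k, j))"
  using assms by (auto simp: scalar_prod_def lessThan_atLeast0 intro!: sum.cong)

text \<open>A summand can be nonzero only if \<open>i \<le> k\<close> (from \<open>A\<close>) and
  \<open>k \<le> j\<close> (from \<open>B\<close>). Below the diagonal the range \<open>i..j\<close>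
  is empty, which yields closure under multiplication.\<close>

lemma index_mult_upper_triangular:
  fixes A B :: "'a :: semiring_0 mat"
  assumes "A \<in> upper_triangular_mats n" "B \<in> upper_triangular_mats n" "i < n" "j < n"
  shows "(A * B) $$ (i, j) = (\<Sum>k = i..j. A $$ (i, k) * B $$ (k, j))"
proof -
  have "(A * B) $$ (i, j) = (\<Sum>k<n. A $$ (i, k) * B $$ (k, j))"
    using assms by (intro index_mult_square_mat upper_triangular_matsD)
  also have "\<dots> = (\<Sum>k = i..j. A $$ (i, k) * B $$ (k, j))"
    using assms by (intro sum.mono_neutral_right) (auto simp: upper_triangular_matsD(2) not_le)
  finally show ?thesis .
qed

lemma mult_square_mat [simp]:
  assumes "A \<in> carrier_mat n n" "B \<in> carrier_mat n n"
  shows "A * B \<in> carrier_mat n n"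
  using assms by (rule mult_carrier_mat)

lemma mult_upper_triangular_mats:
  fixes A B :: "'a :: semiring_0 mat"
  assumes "A \<in> upper_triangular_mats n" "B \<in> upper_triangular_mats n"
  shows "A * B \<in> upper_triangular_mats n"
proof (rule upper_triangular_matsI)
  show "A * B \<in> carrier_mat n n"
    using assms by (auto dest!: upper_triangular_matsD(1))
  show "(A * B) $$ (i, j) = 0" if "j < i" "i < n" for i j
    using that assms by (simp add: index_mult_upper_triangular)
qed

lemma add_upper_triangular_mats:
  fixes A B :: "'a :: monoid_add mat"
  assumes "A \<in> upper_triangular_mats n" "B \<in> upper_triangular_mats n"
  shows "A + B \<in> upper_triangular_mats n"
  using assms
  by (intro upper_triangular_matsI) (auto simp: upper_triangular_matsD)

lemma smult_upper_triangular_mats: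
  fixes A :: "'a :: mult_zero mat"
  assumes "A \<in> upper_triangular_mats n"
  shows "c \<cdot>\<^sub>m A \<in> upper_triangular_mats n"
  using assms
  by (intro upper_triangular_matsI) (auto simp: upper_triangular_matsD)

lemma one_upper_triangular_mats: "1\<^sub>m n \<in> upper_triangular_mats n"
  by (intro upper_triangular_matsI) auto

lemma mat_unit_carrier [simp]: "mat_unit n i j \<in> carrier_mat n n"
  by (simp add: mat_unit_def)

lemma mat_unit_upper_triangular_mats:
  assumes "i \<le> j"
  shows "mat_unit n i j \<in> upper_triangular_mats n"
  using assms by (intro upper_triangular_matsI) (auto simp: mat_unit_def)

lemma mat_sum_carrier [simp]: "mat_sum n I F \<in> carrier_mat n n"
  by (simp add: mat_sum_def)

lemma index_mat_sum:
  assumes "r < n" "s < n"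
  shows "mat_sum n I F $$ (r, s) = (\<Sum>x\<in>I. F x $$ (r, s))"
  using assms by (simp add: mat_sum_def)

lemma mat_sum_upper_triangular_mats:
  assumes "\<And>x. x \<in> I \<Longrightarrow> F x \<in> upper_triangular_mats n"
  shows "mat_sum n I F \<in> upper_triangular_mats n"
  using assms
  by (intro upper_triangular_matsI) (auto simp: index_mat_sum intro!: sum.neutral upper_triangular_matsD(2))

text \<open>The library's unit laws for \<open>1\<^sub>m\<close> assume \<open>0 \<noteq> 1\<close>.\<close>

lemma one_mat_mult:
  fixes A :: "'a :: {comm_ring, semiring_numeral} mat"
  assumes "A \<in> carrier_mat n n"
  shows "1\<^sub>m n * A = A"
proof (rule eq_matI)
  fix i j assume "i < dim_row A" "j < dim_col A"
  then have ij: "i < n" "j < n" using assms by auto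
  have "(1\<^sub>m n * A) $$ (i, j) = (\<Sum>k<n. if k = i then A $$ (k, j) else 0)"
    unfolding index_mult_square_mat[OF one_carrier_mat assms ij]
    using ij by (intro sum.cong) auto
  then show "(1\<^sub>m n * A) $$ (i, j) = A $$ (i, j)" using ij by simp
qed (use assms in auto)

lemma mult_one_mat:
  fixes A :: "'a :: {comm_ring, semiring_numeral} mat"
  assumes "A \<in> carrier_mat n n"
  shows "A * 1\<^sub>m n = A"
proof (rule eq_matI)
  fix i j assume "i < dim_row A" "j < dim_col A"
  then have ij: "i < n" "j < n" using assms by auto
  have "(A * 1\<^sub>m n) $$ (i, j) = (\<Sum>k<n. if k = j then A $$ (i, k) else 0)"
    unfolding index_mult_square_mat[OF assms one_carrier_mat ij]
    using ij by (intro sum.cong) auto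
  then show "(A * 1\<^sub>m n) $$ (i, j) = A $$ (i, j)" using ij by simp
qed (use assms in auto)

section \<open>Matrix units and coordinates\<close>

text \<open>Left multiplication by a matrix unit copies row \<open>j\<close> of \<open>A\<close>
  into row \<open>i\<close> and clears everything else. Units count from 1 and entries from 0, hence
  \<open>Suc r\<close> and \<open>j - 1\<close>.\<close>

lemma index_mat_unit_mult:
  fixes A :: "'a :: {comm_ring, semiring_numeral} mat"
  assumes "A \<in> carrier_mat n n" "r < n" "s < n" "1 \<le> j" "j \<le> n"
  shows "(mat_unit n i j * A) $$ (r, s) = (if Suc r = i then A $$ (j - 1, s) else 0)"
proof -
  have "(mat_unit n i j * A) $$ (r, s)
      = (\<Sum>k<n. if k = j - 1 then (if Suc r = i then A $$ (k, s) else 0) else 0)"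
    unfolding index_mult_square_mat[OF mat_unit_carrier assms(1-3)]
    using assms by (intro sum.cong) (auto simp: mat_unit_def)
  then show ?thesis using assms by auto
qed

lemma mat_unit_mult_mat_unit:
  assumes "1 \<le> j" "j \<le> n"
  shows "mat_unit n i j * mat_unit n k l
    = (if j = k then mat_unit n i l else 0\<^sub>m n n :: 'a :: {comm_ring, semiring_numeral} mat)"
proof (rule eq_matI)
  let ?R = "if j = k then mat_unit n i l else 0\<^sub>m n n :: 'a mat"
  fix r s assume "r < dim_row ?R" "s < dim_col ?R"
  then have rs: "r < n" "s < n" by (auto simp: mat_unit_def split: if_splits)
  show "(mat_unit n i j * mat_unit n k l) $$ (r, s) = ?R $$ (r, s)"
    using rs assms unfolding index_mat_unit_mult[OF mat_unit_carrier rs assms]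
    by (auto simp: mat_unit_def)
qed (auto simp: mat_unit_def)

lemma index_mat_sum_mat_unit:
  fixes c :: "nat \<Rightarrow> nat \<Rightarrow> 'a :: {comm_ring, semiring_numeral}"
  assumes "finite I" "r < n" "s < n"
  shows "mat_sum n I (\<lambda>(i, j). c i j \<cdot>\<^sub>m mat_unit n i j) $$ (r, s)
    = (if (Suc r, Suc s) \<in> I then c (Suc r) (Suc s) else 0)"
proof -
  have "mat_sum n I (\<lambda>(i, j). c i j \<cdot>\<^sub>m mat_unit n i j) $$ (r, s)
      = (\<Sum>x\<in>I. if x = (Suc r, Suc s) then c (Suc r) (Suc s) else 0)"
    unfolding index_mat_sum[OF assms(2,3)]
    using assms by (intro sum.cong refl) (auto simp: mat_unit_def split: if_splits)
  then show ?thesis using assms by simp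
qed

lemma index_mat_sum_mat_unit_row:
  fixes c :: "nat \<Rightarrow> 'a :: {comm_ring, semiring_numeral}"
  assumes "finite J" "r < n" "s < n"
  shows "mat_sum n J (\<lambda>j. c j \<cdot>\<^sub>m mat_unit n i j) $$ (r, s)
    = (if Suc r = i \<and> Suc s \<in> J then c (Suc s) else 0)"
proof -
  have "mat_sum n J (\<lambda>j. c j \<cdot>\<^sub>m mat_unit n i j) $$ (r, s)
      = (\<Sum>j\<in>J. if j = Suc s then (if Suc r = i then c (Suc s) else 0) else 0)"
    unfolding index_mat_sum[OF assms(2,3)]
    using assms by (intro sum.cong refl) (auto simp: mat_unit_def split: if_splits)
  then show ?thesis using assms by auto
qed

lemma add_mat_right_cancel:
  fixes A B C :: "'a :: cancel_ab_semigroup_add mat"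
  assumes "A + C = B + C" "A \<in> carrier_mat m n" "B \<in> carrier_mat m n" "C \<in> carrier_mat m n"
  shows "A = B"
proof (rule eq_matI)
  fix i j assume "i < dim_row B" "j < dim_col B"
  moreover have "(A + C) $$ (i, j) = (B + C) $$ (i, j)" using assms(1) by simp
  ultimately show "A $$ (i, j) = B $$ (i, j)" using assms(2-4) by simp
qed (use assms in auto)

section \<open>Linear maps and right multiplications\<close>

lemma linear_map_onD:
  assumes "linear_map_on S f" "A \<in> S"
  shows "f A \<in> S" "B \<in> S \<Longrightarrow> f (A + B) = f A + f B" "f (c \<cdot>\<^sub>m A) = c \<cdot>\<^sub>m f A"
  using assms by (auto simp: linear_map_on_def)

lemma linear_map_on_mat_sum:
  fixes f :: "'a :: {comm_ring, semiring_numeral} mat \<Rightarrow> 'a mat"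
  assumes lin: "linear_map_on (upper_triangular_mats n) f" and "finite I"
    and "\<And>x. x \<in> I \<Longrightarrow> F x \<in> upper_triangular_mats n"
  shows "f (mat_sum n I F) = mat_sum n I (\<lambda>x. f (F x))"
  using assms(2,3)
proof (induction I rule: finite_induct)
  case empty
  \<comment> \<open>Writing the zero matrix as a multiple by the scalar 0 lets homogeneity give that
    \<open>f\<close> maps zero to zero.\<close>
  have zero: "0\<^sub>m n n = (0 :: 'a) \<cdot>\<^sub>m 0\<^sub>m n n" by auto
  have Z: "(0\<^sub>m n n :: 'a mat) \<in> upper_triangular_mats n"
    by (auto intro: upper_triangular_matsI)
  have "f (0\<^sub>m n n) = 0 \<cdot>\<^sub>m f (0\<^sub>m n n)"
    using linear_map_onD(3)[OF lin Z] zero by metis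
  also have "\<dots> = 0\<^sub>m n n"
    using upper_triangular_matsD(1)[OF linear_map_onD(1)[OF lin Z]] by auto
  finally show ?case by (simp add: mat_sum_empty)
next
  case (insert x I)
  have "f (mat_sum n (insert x I) F) = f (F x + mat_sum n I F)"
    using insert by (subst mat_sum_insert) (auto dest: upper_triangular_matsD(1))
  also have "\<dots> = f (F x) + f (mat_sum n I F)"
    using insert.prems by (intro linear_map_onD(2)[OF lin] mat_sum_upper_triangular_mats) auto
  also have "\<dots> = mat_sum n (insert x I) (\<lambda>x. f (F x))"
    using insert linear_map_onD(1)[OF lin, of "F x"]
    by (subst mat_sum_insert) (auto dest: upper_triangular_matsD(1))
  finally show ?case .
qed

text \<open>Linearity of the candidate map lets it be expanded over matrix units just like
  \<open>f\<close>, so that the two can be compared summand by summand.\<close>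

lemma linear_map_on_mult_right:
  fixes K :: "'a :: {comm_ring, semiring_numeral} mat"
  assumes "K \<in> upper_triangular_mats n"
  shows "linear_map_on (upper_triangular_mats n) (\<lambda>A. A * K)"
  using assms unfolding linear_map_on_def
  by (auto simp: mult_upper_triangular_mats dest!: upper_triangular_matsD(1)
      intro: add_mult_distrib_mat mult_smult_assoc_mat)

text \<open>This is associativity: \<open>(A * B) * K = A * (B * K)\<close>.\<close>

lemma right_centralizer_onI:
  fixes f :: "'a :: {comm_ring, semiring_numeral} mat \<Rightarrow> 'a mat"
  assumes "linear_map_on (upper_triangular_mats n) f" and K: "K \<in> upper_triangular_mats n"
    and f: "\<And>A. A \<in> upper_triangular_mats n \<Longrightarrow> f A = A * K"
  shows "right_centralizer_on (upper_triangular_mats n) f"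
  unfolding right_centralizer_on_def
proof (intro conjI ballI assms(1))
  fix A B :: "'a mat" assume AB: "A \<in> upper_triangular_mats n" "B \<in> upper_triangular_mats n"
  show "f (A * B) = A * f B"
    using AB K by (auto simp: f mult_upper_triangular_mats dest!: upper_triangular_matsD(1))
qed

text \<open>Idempotents span the upper triangular matrices, so two linear maps that agree on
  idempotents agree everywhere. Agreement is first carried over to the matrix units, then to
  \<open>A\<close> by its expansion.\<close>

lemma linear_map_on_eq_mult_right:
  fixes f :: "'a :: {comm_ring, semiring_numeral} mat \<Rightarrow> 'a mat"
  assumes lin: "linear_map_on (upper_triangular_mats n) f" and K: "K \<in> upper_triangular_mats n"
    and idem: "\<And>E. E \<in> upper_triangular_mats n \<Longrightarrow> E * E = E \<Longrightarrow> f E = E * K"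
    and A: "A \<in> upper_triangular_mats n"
  shows "f A = A * K"
proof -
  have Kc: "K \<in> carrier_mat n n" using K by (rule upper_triangular_matsD(1))
  have unit: "f (mat_unit n i j) = mat_unit n i j * K" if ij: "1 \<le> i" "i \<le> j" "j \<le> n" for i j
  proof -
    let ?D = "mat_unit n i i :: 'a mat" and ?E = "mat_unit n i j :: 'a mat"
    have T: "?D \<in> upper_triangular_mats n" "?E \<in> upper_triangular_mats n"
      using ij by (auto intro: mat_unit_upper_triangular_mats)
    have DD: "?D * ?D = ?D" "?D * ?E = ?E"
      using ij by (auto simp: mat_unit_mult_mat_unit)
    show ?thesis
    proof (cases "i = j")
      case True
      then show ?thesis using idem T DD by blast
    next
      case False
      then have E: "?E * ?D = 0\<^sub>m n n" "?E * ?E = 0\<^sub>m n n"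
        using ij by (auto simp: mat_unit_mult_mat_unit)
      \<comment> \<open>For \<open>i < j\<close> the unit \<open>?E\<close> squares to zero, but
        \<open>?D + ?E\<close> is idempotent; subtracting the known value at \<open>?D\<close>
        leaves the value at \<open>?E\<close>.\<close>
      have "(?D + ?E) * (?D + ?E) = ?D + ?E"
        by (simp add: add_mult_distrib_mat[of _ n n _ _ n] mult_add_distrib_mat[of _ n n _ n] DD E)
      then have "f (?D + ?E) = (?D + ?E) * K"
        using idem T add_upper_triangular_mats by blast
      then have sum: "f ?D + f ?E = ?D * K + ?E * K"
        using linear_map_onD(2)[OF lin T] Kc by (simp add: add_mult_distrib_mat[of _ n n _ _ n])
      have D: "f ?D = ?D * K" using idem T DD by blast
      have fE: "f ?E \<in> carrier_mat n n"
        using linear_map_onD(1)[OF lin T(2)] by (rule upper_triangular_matsD(1))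
      have "f ?E + ?D * K = ?E * K + ?D * K"
        using sum fE Kc by (simp add: D comm_add_mat[of _ n n])
      then show ?thesis
        by (rule add_mat_right_cancel[where m = n and n = n]) (use fE Kc in auto)
    qed
  qed
  let ?F = "\<lambda>(i, j). (A $$ (i - 1, j - 1)) \<cdot>\<^sub>m mat_unit n i j :: 'a mat"
  have F: "?F x \<in> upper_triangular_mats n" if "x \<in> upper_indices n" for x
    using that by (auto intro: smult_upper_triangular_mats mat_unit_upper_triangular_mats)
  have "f (?F x) = ?F x * K" if "x \<in> upper_indices n" for x
    using that Kc
    by (auto simp: linear_map_onD(3)[OF lin] mat_unit_upper_triangular_mats unit
        mult_smult_assoc_mat[OF mat_unit_carrier Kc])
  then have "mat_sum n (upper_indices n) (\<lambda>x. f (?F x)) = mat_sum n (upper_indices n) (\<lambda>x. ?F x * K)"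
    unfolding mat_sum_def by (intro cong_mat sum.cong) auto
  then have "f (mat_sum n (upper_indices n) ?F) = mat_sum n (upper_indices n) ?F * K"
    by (simp only: linear_map_on_mat_sum[OF lin finite_upper_indices F]
        linear_map_on_mat_sum[OF linear_map_on_mult_right[OF K] finite_upper_indices F])
  then show ?thesis
    unfolding upper_triangular_mats_expansion[OF A, symmetric] .
qed

section \<open>Consequences of the Jordan identity\<close>

lemma two_smult_mat:
  fixes A :: "'a :: {comm_ring, semiring_numeral} mat"
  shows "2 \<cdot>\<^sub>m A = A + A"
  by (intro eq_matI) (auto simp: mult_2)

text \<open>Torsion freeness is applied to the difference of each pair of entries; this is how the
  factor 2 of the Jordan identity is removed.\<close>

lemma double_mat_cancel:
  fixes A B :: "'a :: {comm_ring, semiring_numeral} mat"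
  assumes tf: "two_torsion_free TYPE('a)" and "A + A = B + B"
    and "A \<in> carrier_mat n n" "B \<in> carrier_mat n n"
  shows "A = B"
proof (rule eq_matI)
  fix i j assume ij: "i < dim_row B" "j < dim_col B"
  have "(A + A) $$ (i, j) = (B + B) $$ (i, j)" using assms by simp
  then have "2 * (A $$ (i, j) - B $$ (i, j)) = 0"
    using ij assms(3,4) by (simp add: mult_2)
  then show "A $$ (i, j) = B $$ (i, j)"
    using tf unfolding two_torsion_free_def by (metis eq_iff_diff_eq_0)
qed (use assms in auto)

lemma jordan_left_derivation_onD:
  assumes "jordan_left_derivation_on S g h f" "A \<in> S" "B \<in> S"
  shows "f (A * B + B * A) = 2 \<cdot>\<^sub>m (A * g B + B * h A)"
  using assms by (simp add: jordan_left_derivation_on_def)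

text \<open>A right multiplication is determined by its value at the identity matrix, so
  \<open>G\<close> and \<open>H\<close> have to be the values of \<open>g\<close> and
  \<open>h\<close> there. The last conclusion comes from applying the identity to matrix units that
  do not commute.\<close>

lemma jordan_left_derivation_on_imp_mult_right:
  fixes f g h :: "'a :: {comm_ring, semiring_numeral} mat \<Rightarrow> 'a mat"
  assumes tf: "two_torsion_free TYPE('a)"
    and f: "linear_map_on (upper_triangular_mats n) f"
    and g: "linear_map_on (upper_triangular_mats n) g"
    and h: "linear_map_on (upper_triangular_mats n) h"
    and J: "jordan_left_derivation_on (upper_triangular_mats n) g h f"
  obtains G H where "G \<in> upper_triangular_mats n" "H \<in> upper_triangular_mats n"
    "\<And>A. A \<in> upper_triangular_mats n \<Longrightarrow> f A = A * (G + H)"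
    "\<And>A. A \<in> upper_triangular_mats n \<Longrightarrow> g A = A * G"
    "\<And>A. A \<in> upper_triangular_mats n \<Longrightarrow> h A = A * H"
    "\<And>k s. 1 \<le> k \<Longrightarrow> k < n \<Longrightarrow> s < n \<Longrightarrow> G $$ (k, s) = H $$ (k, s)"
proof -
  let ?T = "upper_triangular_mats n :: 'a mat set"
  define G H where "G = g (1\<^sub>m n)" and "H = h (1\<^sub>m n)"
  have G: "G \<in> ?T" and H: "H \<in> ?T"
    unfolding G_def H_def
    using linear_map_onD(1)[OF g one_upper_triangular_mats]
      linear_map_onD(1)[OF h one_upper_triangular_mats] by auto
  note carr = upper_triangular_matsD(1)
  have Gc: "G \<in> carrier_mat n n" and Hc: "H \<in> carrier_mat n n" using G H carr by auto
  have fc: "f A \<in> carrier_mat n n" and gc: "g A \<in> carrier_mat n n" and hc: "h A \<in> carrier_mat n n"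
    if "A \<in> ?T" for A
    using that linear_map_onD(1)[OF f that] linear_map_onD(1)[OF g that]
      linear_map_onD(1)[OF h that] carr by auto
  \<comment> \<open>The Jordan identity with one argument equal to \<open>1\<^sub>m n\<close>,
    halved; the two orders of the arguments give the two formulas.\<close>
  have fh: "f A = A * G + h A" and fg: "f A = g A + A * H" if A: "A \<in> ?T" for A
  proof -
    note Ac = carr[OF A]
    have "f A + f A = (A * G + h A) + (A * G + h A)"
      using jordan_left_derivation_onD[OF J A one_upper_triangular_mats]
      by (simp add: one_mat_mult[OF Ac] mult_one_mat[OF Ac] one_mat_mult[OF hc[OF A]]
          linear_map_onD(2)[OF f A A] two_smult_mat G_def)
    then show "f A = A * G + h A"
        by (rule double_mat_cancel[OF tf, where n = n]) (use Ac Gc fc[OF A] hc[OF A] in auto)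
    have "f A + f A = (g A + A * H) + (g A + A * H)"
      using jordan_left_derivation_onD[OF J one_upper_triangular_mats A]
      by (simp add: one_mat_mult[OF Ac] mult_one_mat[OF Ac] one_mat_mult[OF gc[OF A]]
          linear_map_onD(2)[OF f A A] two_smult_mat H_def)
    then show "f A = g A + A * H"
        by (rule double_mat_cancel[OF tf, where n = n]) (use Ac Hc fc[OF A] gc[OF A] in auto)
  qed
  \<comment> \<open>By the Jordan identity at \<open>(E, E)\<close>, \<open>f E\<close> is a left
    multiple of \<open>E\<close>, so \<open>E * f E = f E\<close>. Multiplying \<open>fh\<close> and
    \<open>fg\<close> by \<open>E\<close> on the left then gives two more expressions for
    \<open>f E\<close>, and cancellation identifies \<open>E * g E\<close> with \<open>E * G\<close>
    and \<open>E * h E\<close> with \<open>E * H\<close>.\<close>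
  have idem: "f E = E * (G + H)" if E: "E \<in> ?T" "E * E = E" for E
  proof -
    note Ec = carr[OF E(1)] and fE = fc[OF E(1)] and gE = gc[OF E(1)] and hE = hc[OF E(1)]
    have "f E + f E = (E * g E + E * h E) + (E * g E + E * h E)"
      using jordan_left_derivation_onD[OF J E(1) E(1)]
      by (simp add: E(2) linear_map_onD(2)[OF f E(1) E(1)] two_smult_mat)
    then have 1: "f E = E * g E + E * h E"
        by (rule double_mat_cancel[OF tf, where n = n]) (use Ec fE gE hE in auto)
    have absorb: "E * (E * X) = E * X" if "X \<in> carrier_mat n n" for X
      using assoc_mult_mat[OF Ec Ec that] E(2) by simp
    have Ef: "E * f E = E * g E + E * h E"
      using Ec gE hE by (subst 1) (simp add: mult_add_distrib_mat[of _ n n _ n] absorb)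
    have 2: "E * f E = E * G + E * h E"
      using Ec Gc hE by (subst fh[OF E(1)]) (simp add: mult_add_distrib_mat[of _ n n _ n] absorb)
    have 3: "E * f E = E * g E + E * H"
      using Ec Hc gE by (subst fg[OF E(1)]) (simp add: mult_add_distrib_mat[of _ n n _ n] absorb)
    have 4: "E * f E = f E" using 1 Ef by simp
    show ?thesis
    proof (rule eq_matI)
      fix i j assume "i < dim_row (E * (G + H))" "j < dim_col (E * (G + H))"
      then have ij: "i < n" "j < n" using Ec Hc by auto
      have add: "(X + Y) $$ (i, j) = X $$ (i, j) + Y $$ (i, j)" if "Y \<in> carrier_mat n n" for X Y :: "'a mat"
        using that ij by auto
      have c: "E * X \<in> carrier_mat n n" if "X \<in> carrier_mat n n" for X
        using that Ec by auto
      have "f E $$ (i, j) = (E * g E) $$ (i, j) + (E * h E) $$ (i, j)"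
        "f E $$ (i, j) = (E * G) $$ (i, j) + (E * h E) $$ (i, j)"
        "f E $$ (i, j) = (E * g E) $$ (i, j) + (E * H) $$ (i, j)"
        using 1 2 3 4 add[OF c[OF hE]] add[OF c[OF Hc]] by metis+
      then have "f E $$ (i, j) = (E * G) $$ (i, j) + (E * H) $$ (i, j)"
        by (metis add_right_cancel add_left_cancel)
      then show "f E $$ (i, j) = (E * (G + H)) $$ (i, j)"
        using add[OF c[OF Hc]] by (simp add: mult_add_distrib_mat[OF Ec Gc Hc])
    qed (use Ec fE Hc in auto)
  qed
  have fGH: "f A = A * (G + H)" if "A \<in> ?T" for A
    by (rule linear_map_on_eq_mult_right[OF f add_upper_triangular_mats[OF G H] idem that])
  \<comment> \<open>With \<open>f\<close> known, \<open>fg\<close> and \<open>fh\<close> determine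
    \<open>g\<close> and \<open>h\<close> by cancelling \<open>A * H\<close> and
    \<open>A * G\<close>.\<close>
  have gG: "g A = A * G" and hH: "h A = A * H" if A: "A \<in> ?T" for A
  proof -
    note Ac = carr[OF A]
    have fA: "f A = A * G + A * H"
      using fGH[OF A] by (simp add: mult_add_distrib_mat[OF Ac Gc Hc])
    then show "g A = A * G"
      using fg[OF A] Ac Gc Hc gc[OF A]
      by (intro add_mat_right_cancel[of "g A" "A * H" "A * G" n n]) auto
    have "h A + A * G = A * H + A * G"
      using fA fh[OF A] Ac Gc Hc hc[OF A] by (simp add: comm_add_mat[of _ n n])
    then show "h A = A * H"
      by (rule add_mat_right_cancel[where m = n and n = n]) (use Ac Gc Hc hc[OF A] in auto)
  qed
  have "G $$ (k, s) = H $$ (k, s)" if k: "1 \<le> k" "k < n" "s < n" for k s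
  proof -
    \<comment> \<open>Since \<open>?D * ?E = ?E\<close> and \<open>?E * ?D\<close> is zero, the
      Jordan identity becomes \<open>?E * (G + H) = 2 \<cdot>\<^sub>m (?E * G)\<close>, that is,
      \<open>?E * H = ?E * G\<close>. The column index \<open>Suc k\<close> selects the row numbered
      \<open>k\<close> from 0.\<close>
    let ?D = "mat_unit n 1 1 :: 'a mat" and ?E = "mat_unit n 1 (Suc k) :: 'a mat"
    have T: "?D \<in> ?T" "?E \<in> ?T" by (auto intro: mat_unit_upper_triangular_mats)
    have DE: "?D * ?E = ?E" "?E * ?D = 0\<^sub>m n n"
      using k by (auto simp: mat_unit_mult_mat_unit)
    have "?E * (G + H) = 2 \<cdot>\<^sub>m (?D * (?E * G) + ?E * (?D * H))"
      using jordan_left_derivation_onD[OF J T] by (simp add: DE fGH gG hH T del: One_nat_def)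
    also have "\<dots> = ?E * G + ?E * G"
      using Gc Hc by (simp flip: assoc_mult_mat[of _ n n _ n _ n] add: DE two_smult_mat del: One_nat_def)
    finally have "?E * H + ?E * G = ?E * G + ?E * G"
      using Gc Hc by (metis comm_add_mat mult_add_distrib_mat mult_carrier_mat mat_unit_carrier)
    then have "?E * H = ?E * G"
      by (rule add_mat_right_cancel[where m = n and n = n]) (use Gc Hc in auto)
    moreover have "(?E * X) $$ (0, s) = X $$ (k, s)" if "X \<in> carrier_mat n n" for X
      using index_mat_unit_mult[OF that, of 0 s "Suc k" 1] k by simp
    ultimately show ?thesis using Gc Hc by metis
  qed
  then show ?thesis using that[OF G H fGH gG hH] by blast
qed

text \<open>The two sides of the Jordan identity differ by \<open>(A * B - B * A) * (G - H)\<close>.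
  The commutator has zero first column, and \<open>G - H\<close> is zero outside the first row, so
  the product vanishes.\<close>

lemma jordan_left_derivation_on_mult_right:
  fixes f g h :: "'a :: {comm_ring, semiring_numeral} mat \<Rightarrow> 'a mat"
  assumes G: "G \<in> upper_triangular_mats n" and H: "H \<in> upper_triangular_mats n"
    and f: "\<And>A. A \<in> upper_triangular_mats n \<Longrightarrow> f A = A * (G + H)"
    and g: "\<And>A. A \<in> upper_triangular_mats n \<Longrightarrow> g A = A * G"
    and h: "\<And>A. A \<in> upper_triangular_mats n \<Longrightarrow> h A = A * H"
    and rows: "\<And>k s. 1 \<le> k \<Longrightarrow> k < n \<Longrightarrow> s < n \<Longrightarrow> G $$ (k, s) = H $$ (k, s)"
  shows "jordan_left_derivation_on (upper_triangular_mats n) g h f"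
  unfolding jordan_left_derivation_on_def
proof (intro ballI)
  fix A B :: "'a mat"
  assume A: "A \<in> upper_triangular_mats n" and B: "B \<in> upper_triangular_mats n"
  note carr = upper_triangular_matsD(1)
  note c = carr[OF A] carr[OF B] carr[OF G] carr[OF H]
  have AB: "A * B \<in> upper_triangular_mats n" and BA: "B * A \<in> upper_triangular_mats n"
    using A B by (auto intro: mult_upper_triangular_mats)
  note c2 = carr[OF AB] carr[OF BA]
  \<comment> \<open>This is the vanishing of \<open>(A * B - B * A) * (G - H)\<close> written
    without subtraction; it is proved for each summand of the matrix products.\<close>
  have comm: "(A * B * H) $$ (i, j) + (B * A * G) $$ (i, j)
      = (A * B * G) $$ (i, j) + (B * A * H) $$ (i, j)" if ij: "i < n" "j < n" for i j
  proof -
    have "(A * B) $$ (i, k) * H $$ (k, j) + (B * A) $$ (i, k) * G $$ (k, j)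
        = (A * B) $$ (i, k) * G $$ (k, j) + (B * A) $$ (i, k) * H $$ (k, j)" if k: "k < n" for k
    proof (cases "k = 0")
      case True
      \<comment> \<open>In column 0 both products vanish below the diagonal, and their corner
        entries agree because the coefficients commute.\<close>
      then have "(A * B) $$ (i, k) = (B * A) $$ (i, k)"
        using A B AB BA ij k
        by (cases "i = 0")
          (auto simp: index_mult_upper_triangular upper_triangular_matsD(2) mult.commute
            simp del: index_mult_mat(1))
      then show ?thesis by (simp add: add.commute del: index_mult_mat(1))
    next
      case False
      then show ?thesis using rows k ij by simp
    qed
    then show ?thesis
      using ij
      by (simp add: index_mult_square_mat[OF c2(1)] index_mult_square_mat[OF c2(2)] c
          del: index_mult_mat(1) flip: sum.distrib)
  qed
  have "f (A * B + B * A) = (A * B + B * A) * (G + H)"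
    using f add_upper_triangular_mats[OF AB BA] by simp
  also have "\<dots> = (A * B * G + B * A * G) + (A * B * H + B * A * H)" (is "_ = ?L")
    using c c2 by (simp add: add_mult_distrib_mat[of _ n n _ _ n] mult_add_distrib_mat[of _ n n _ n])
  also have "\<dots> = (A * B * G + B * A * H) + (A * B * G + B * A * H)" (is "_ = ?R")
  proof (rule eq_matI)
    fix i j assume "i < dim_row ?R" "j < dim_col ?R"
    then have ij: "i < n" "j < n" using c by auto
    let ?e = "\<lambda>M. M $$ (i, j)"
    have "?L $$ (i, j) = (?e (A * B * G) + ?e (B * A * G)) + (?e (A * B * H) + ?e (B * A * H))"
      using ij c by (simp del: index_mult_mat(1))
    \<comment> \<open>The regrouping brings the left-hand side of \<open>comm\<close> together, so
      that rewriting with it produces two equal halves.\<close>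
    also have "\<dots> = (?e (A * B * H) + ?e (B * A * G)) + (?e (A * B * G) + ?e (B * A * H))"
      by (simp only: ac_simps)
    also have "\<dots> = ?R $$ (i, j)"
      unfolding comm[OF ij] using ij c by (simp del: index_mult_mat(1))
    finally show "?L $$ (i, j) = ?R $$ (i, j)" .
  qed (use c in auto)
  also have "\<dots> = 2 \<cdot>\<^sub>m (A * g B + B * h A)"
    using c by (simp add: two_smult_mat g h A B)
  finally show "f (A * B + B * A) = 2 \<cdot>\<^sub>m (A * g B + B * h A)" .
qed

section \<open>Coordinate formulas for right multiplications\<close>

text \<open>Translates between right multiplication and the sums in the theorem. The families
  \<open>a\<close> and \<open>c\<close> are arbitrary functions, tied to the entries of
  \<open>A\<close> and \<open>G\<close> only on and above the diagonal.\<close>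

lemma mult_right_eq_mat_sum:
  fixes a c :: "nat \<Rightarrow> nat \<Rightarrow> 'a :: {comm_ring, semiring_numeral}"
  assumes A: "A \<in> upper_triangular_mats n" and G: "G \<in> upper_triangular_mats n"
    and a: "A = mat_sum n (upper_indices n) (\<lambda>(i, j). a i j \<cdot>\<^sub>m mat_unit n i j)"
    and c: "\<And>k j. 1 \<le> k \<Longrightarrow> k \<le> j \<Longrightarrow> j \<le> n \<Longrightarrow> G $$ (k - 1, j - 1) = c k j"
  shows "A * G = mat_sum n (upper_indices n)
    (\<lambda>(i, j). (\<Sum>k = i..j. a i k * c k j) \<cdot>\<^sub>m mat_unit n i j)" (is "_ = ?R")
proof (rule eq_matI)
  fix r s assume "r < dim_row ?R" "s < dim_col ?R"
  then have rs: "r < n" "s < n" by (auto simp: mat_sum_def)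
  have entry: "A $$ (i, j) = a (Suc i) (Suc j)" if "i \<le> j" "j < n" for i j
    using that
      index_mat_sum_mat_unit[OF finite_upper_indices[of n], where r = i and s = j and n = n and c = a]
    unfolding a[symmetric] by simp
  have "(A * G) $$ (r, s) = (\<Sum>k = r..s. A $$ (r, k) * G $$ (k, s))"
    by (rule index_mult_upper_triangular[OF A G rs])
  also have "\<dots> = (\<Sum>k = r..s. a (Suc r) (Suc k) * c (Suc k) (Suc s))"
    using rs c[of "Suc _" "Suc s"] by (intro sum.cong) (auto simp: entry)
  \<comment> \<open>Passage from summation indices counted from 0 to indices counted from 1.\<close>
  also have "\<dots> = (\<Sum>k = Suc r..Suc s. a (Suc r) k * c k (Suc s))"
    by (rule sum.shift_bounds_cl_Suc_ivl[symmetric])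
  also have "\<dots> = ?R $$ (r, s)"
    unfolding index_mat_sum_mat_unit[OF finite_upper_indices rs]
    using rs by (simp del: sum.cl_ivl_Suc)
  finally show "(A * G) $$ (r, s) = ?R $$ (r, s)" .
qed (use A G in \<open>auto simp: mat_sum_def upper_triangular_mats_def\<close>)

text \<open>Brings the coordinates of \<open>h\<close> into the shape used in the theorem. The
  family \<open>d\<close> differs from \<open>c\<close> at most in row 1, and row 1 of
  \<open>d\<close> enters only through the term with \<open>i = k = 1\<close>.\<close>

lemma mat_sum_split_first_row:
  fixes a c :: "nat \<Rightarrow> nat \<Rightarrow> 'a :: {comm_ring, semiring_numeral}"
  assumes row: "\<And>j. d 1 j = e j" and rest: "\<And>k j. k \<noteq> 1 \<Longrightarrow> d k j = c k j"
  shows "mat_sum n (upper_indices n) (\<lambda>(i, j). (\<Sum>k = i..j. a i k * d k j) \<cdot>\<^sub>m mat_unit n i j)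
    = (a 1 1 * e 1) \<cdot>\<^sub>m mat_unit n 1 1
      + mat_sum n {2..n} (\<lambda>j. (a 1 1 * e j + (\<Sum>k = 2..j. a 1 k * c k j)) \<cdot>\<^sub>m mat_unit n 1 j)
      + mat_sum n {(i, j). 1 < i \<and> i \<le> j \<and> j \<le> n}
          (\<lambda>(i, j). (\<Sum>k = i..j. a i k * c k j) \<cdot>\<^sub>m mat_unit n i j)" (is "?L = ?M + ?N + ?O")
proof (rule eq_matI)
  fix r s assume "r < dim_row (?M + ?N + ?O)" "s < dim_col (?M + ?N + ?O)"
  then have rs: "r < n" "s < n" by (auto simp: mat_sum_def)
  have fin: "finite {(i, j). 1 < i \<and> i \<le> j \<and> j \<le> n}"
    by (rule finite_subset[OF _ finite_upper_indices[of n]]) auto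
  have L: "?L $$ (r, s) = (if r \<le> s then \<Sum>k = Suc r..Suc s. a (Suc r) k * d k (Suc s) else 0)"
    unfolding index_mat_sum_mat_unit[OF finite_upper_indices rs]
    using rs by (simp del: sum.cl_ivl_Suc)
  have M: "?M $$ (r, s) = (if r = 0 \<and> s = 0 then a 1 1 * e 1 else 0)"
    using rs by (simp add: mat_unit_def)
  have N: "?N $$ (r, s) = (if r = 0 \<and> 0 < s then
      a 1 1 * e (Suc s) + (\<Sum>k = 2..Suc s. a 1 k * c k (Suc s)) else 0)"
    using rs index_mat_sum_mat_unit_row[of "{2..n}" r n s _ 1] by (auto simp del: sum.cl_ivl_Suc)
  have O: "?O $$ (r, s) = (if 0 < r \<and> r \<le> s then
      \<Sum>k = Suc r..Suc s. a (Suc r) k * c k (Suc s) else 0)"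
    unfolding index_mat_sum_mat_unit[OF fin rs] using rs by (simp del: sum.cl_ivl_Suc)
  have "(?M + ?N + ?O) $$ (r, s) = ?M $$ (r, s) + ?N $$ (r, s) + ?O $$ (r, s)"
    using rs by (auto simp: mat_sum_def mat_unit_def)
  also have "\<dots> = ?L $$ (r, s)"
  proof (cases "r = 0")
    case True
    \<comment> \<open>The \<open>k = 1\<close> term is split off. For \<open>s = 0\<close> the
      remaining sum is empty and the entry is that of \<open>?M\<close>; otherwise it is that of
      \<open>?N\<close>.\<close>
    have "(\<Sum>k = 1..Suc s. a 1 k * d k (Suc s))
        = a 1 1 * e (Suc s) + (\<Sum>k = 2..Suc s. a 1 k * d k (Suc s))"
      by (subst sum.atLeast_Suc_atMost) (auto simp: row[simplified] numeral_2_eq_2 simp del: sum.cl_ivl_Suc)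
    also have "(\<Sum>k = 2..Suc s. a 1 k * d k (Suc s)) = (\<Sum>k = 2..Suc s. a 1 k * c k (Suc s))"
      by (intro sum.cong) (auto simp: rest)
    finally show ?thesis
      using True unfolding L M N O by (cases "s = 0") (simp_all del: sum.cl_ivl_Suc)
  next
    case False
    \<comment> \<open>Here every summation index is at least 2, where \<open>d\<close> and
      \<open>c\<close> coincide.\<close>
    then have "(\<Sum>k = Suc r..Suc s. a (Suc r) k * c k (Suc s))
        = (\<Sum>k = Suc r..Suc s. a (Suc r) k * d k (Suc s))"
      by (intro sum.cong) (auto simp: rest)
    then show ?thesis using False unfolding L M N O by (simp del: sum.cl_ivl_Suc)
  qed
  finally show "?L $$ (r, s) = (?M + ?N + ?O) $$ (r, s)" by simp
qed (auto simp: mat_sum_def)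

theorem theorem2p5:
  fixes n :: nat
    and f g h :: "'a :: {comm_ring, semiring_numeral} mat \<Rightarrow> 'a mat"
  assumes "two_torsion_free TYPE('a)"
    and "n \<ge> 2"
    and "linear_map_on (upper_triangular_mats n) f"
    and "linear_map_on (upper_triangular_mats n) g"
    and "linear_map_on (upper_triangular_mats n) h"
  shows
    "(jordan_left_derivation_on (upper_triangular_mats n) g h f \<longleftrightarrow>
       (\<exists>(gc :: nat \<Rightarrow> nat \<Rightarrow> 'a) (hc :: nat \<Rightarrow> 'a).
          \<forall>A \<in> upper_triangular_mats n. \<forall>a :: nat \<Rightarrow> nat \<Rightarrow> 'a.
            A = mat_sum n {(i, j). 1 \<le> i \<and> i \<le> j \<and> j \<le> n} (\<lambda>(i, j). a i j \<cdot>\<^sub>m mat_unit n i j) \<longrightarrow>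
            g A = mat_sum n {(i, j). 1 \<le> i \<and> i \<le> j \<and> j \<le> n}
                    (\<lambda>(i, j). (\<Sum>k = i..j. a i k * gc k j) \<cdot>\<^sub>m mat_unit n i j) \<and>
            h A = (a 1 1 * hc 1) \<cdot>\<^sub>m mat_unit n 1 1
                  + mat_sum n {2..n}
                      (\<lambda>j. (a 1 1 * hc j + (\<Sum>k = 2..j. a 1 k * gc k j)) \<cdot>\<^sub>m mat_unit n 1 j)
                  + mat_sum n {(i, j). 1 < i \<and> i \<le> j \<and> j \<le> n}
                      (\<lambda>(i, j). (\<Sum>k = i..j. a i k * gc k j) \<cdot>\<^sub>m mat_unit n i j) \<and>
            f A = g A + h A)) \<and>
     (jordan_left_derivation_on (upper_triangular_mats n) g h f \<longrightarrow>
        right_centralizer_on (upper_triangular_mats n) f \<and>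
        right_centralizer_on (upper_triangular_mats n) g \<and>
        right_centralizer_on (upper_triangular_mats n) h)"
proof -
  let ?T = "upper_triangular_mats n :: 'a mat set"
  let ?expansion = "\<lambda>A a. A = mat_sum n (upper_indices n) (\<lambda>(i, j). a i j \<cdot>\<^sub>m mat_unit n i j)"
  let ?R = "\<lambda>a c. mat_sum n (upper_indices n)
    (\<lambda>(i, j). (\<Sum>k = i..j. a i k * c k j) \<cdot>\<^sub>m mat_unit n i j) :: 'a mat"
  let ?h = "\<lambda>(gc :: nat \<Rightarrow> nat \<Rightarrow> 'a) hc a. (a 1 1 * hc 1) \<cdot>\<^sub>m mat_unit n 1 1
    + mat_sum n {2..n} (\<lambda>j. (a 1 1 * hc j + (\<Sum>k = 2..j. a 1 k * gc k j)) \<cdot>\<^sub>m mat_unit n 1 j)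
    + mat_sum n {(i, j). 1 < i \<and> i \<le> j \<and> j \<le> n}
        (\<lambda>(i, j). (\<Sum>k = i..j. a i k * gc k j) \<cdot>\<^sub>m mat_unit n i j)"
  let ?formulas = "\<lambda>(gc :: nat \<Rightarrow> nat \<Rightarrow> 'a) hc. \<forall>A\<in>?T. \<forall>a. ?expansion A a \<longrightarrow>
    g A = ?R a gc \<and> h A = ?h gc hc a \<and> f A = g A + h A"
  \<comment> \<open>The combined family, \<open>hc\<close> in row 1 and \<open>gc\<close> in the
    other rows, describes right multiplication by a single matrix.\<close>
  have split: "?R a (\<lambda>k j. if k = 1 then hc j else gc k j) = ?h gc hc a" for a gc hc
    by (rule mat_sum_split_first_row) auto
  have formulas: "\<exists>gc hc. ?formulas gc hc"
    and centralizers: "right_centralizer_on ?T f \<and> right_centralizer_on ?T g \<and> right_centralizer_on ?T h"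
    if J: "jordan_left_derivation_on ?T g h f"
  proof -
    obtain G H where GH: "G \<in> ?T" "H \<in> ?T"
      and f: "\<And>A. A \<in> ?T \<Longrightarrow> f A = A * (G + H)"
      and g: "\<And>A. A \<in> ?T \<Longrightarrow> g A = A * G"
      and h: "\<And>A. A \<in> ?T \<Longrightarrow> h A = A * H"
      and rows: "\<And>k s. 1 \<le> k \<Longrightarrow> k < n \<Longrightarrow> s < n \<Longrightarrow> G $$ (k, s) = H $$ (k, s)"
      by (rule jordan_left_derivation_on_imp_mult_right[OF assms(1,3-5) J]) (rule that)
    show "right_centralizer_on ?T f \<and> right_centralizer_on ?T g \<and> right_centralizer_on ?T h"
      using right_centralizer_onI[OF assms(3) add_upper_triangular_mats[OF GH] f]
        right_centralizer_onI[OF assms(4) GH(1) g] right_centralizer_onI[OF assms(5) GH(2) h]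
      by blast
    \<comment> \<open>The coefficients are the entries of \<open>G\<close> and the first row of
      \<open>H\<close>, renumbered from 1. The other rows of \<open>H\<close> are covered by
      \<open>gc\<close> because of \<open>rows\<close>.\<close>
    define gc hc where "gc k j = G $$ (k - 1, j - 1)" and "hc j = H $$ (0, j - 1)" for k j
    have "?formulas gc hc"
    proof (intro ballI allI impI)
      fix A a assume A: "A \<in> ?T" and a: "?expansion A a"
      have "g A = ?R a gc"
        unfolding g[OF A] by (rule mult_right_eq_mat_sum[OF A GH(1) a]) (simp add: gc_def)
      moreover have "h A = ?R a (\<lambda>k j. if k = 1 then hc j else gc k j)"
        unfolding h[OF A]
        by (rule mult_right_eq_mat_sum[OF A GH(2) a]) (auto simp: gc_def hc_def rows)
      moreover have "f A = g A + h A"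
        using A GH by (simp add: f g h upper_triangular_matsD(1)
            mult_add_distrib_mat[of _ n n _ n])
      ultimately show "g A = ?R a gc \<and> h A = ?h gc hc a \<and> f A = g A + h A"
        unfolding split by blast
    qed
    then show "\<exists>gc hc. ?formulas gc hc" by blast
  qed
  have jordan: "jordan_left_derivation_on ?T g h f" if F': "\<exists>gc hc. ?formulas gc hc"
  proof -
    obtain gc hc where F: "?formulas gc hc" using F' by (elim exE)
    \<comment> \<open>Rebuilds the multiplying matrix from a coefficient family; \<open>M gc\<close>
      and \<open>M ?d\<close> will be \<open>G\<close> and \<open>H\<close>.\<close>
    define M :: "(nat \<Rightarrow> nat \<Rightarrow> 'a) \<Rightarrow> 'a mat"
      where "M c = mat n n (\<lambda>(i, j). if i \<le> j then c (Suc i) (Suc j) else 0)" for c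
    let ?d = "\<lambda>k j. if k = 1 then hc j else gc k j"
    have M: "M c \<in> ?T" for c
      by (rule upper_triangular_matsI) (auto simp: M_def)
    have MR: "A * M c = ?R (\<lambda>i j. A $$ (i - 1, j - 1)) c" if A: "A \<in> ?T" for A c
      by (rule mult_right_eq_mat_sum[OF A M upper_triangular_mats_expansion[OF A]])
        (auto simp: M_def)
    have g: "g A = A * M gc" and h: "h A = A * M ?d" and f: "f A = A * (M gc + M ?d)"
      if A: "A \<in> ?T" for A
    proof -
      \<comment> \<open>The formulas hold for every family of coordinates of \<open>A\<close>, in
        particular for its own entries.\<close>
      let ?a = "\<lambda>i j. A $$ (i - 1, j - 1)"
      have *: "g A = ?R ?a gc \<and> h A = ?h gc hc ?a \<and> f A = g A + h A"
        by (rule F[rule_format, OF A upper_triangular_mats_expansion[OF A]])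
      show gA: "g A = A * M gc" unfolding MR[OF A] using * by blast
      show hA: "h A = A * M ?d" unfolding MR[OF A] split using * by blast
      have "f A = A * M gc + A * M ?d" unfolding gA[symmetric] hA[symmetric] using * by blast
      then show "f A = A * (M gc + M ?d)"
        by (simp only: mult_add_distrib_mat[OF A[THEN upper_triangular_matsD(1)]
              M[THEN upper_triangular_matsD(1)] M[THEN upper_triangular_matsD(1)]])
    qed
    show ?thesis
      \<comment> \<open>Below the first row the two matrices agree, as \<open>?d\<close> differs
        from \<open>gc\<close> at most at \<open>k = 1\<close>.\<close>
      by (rule jordan_left_derivation_on_mult_right[OF M M f g h]) (auto simp: M_def)
  qed
  show ?thesis
    by (rule conjI[OF iffI[OF formulas jordan] impI[OF centralizers]])
qed

end
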